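(* Let $\lambda$ be a nonzero real number and let $x,y\in\mathbb{R}$. For every integer $n\ge 0$, $$C_{n,\lambda}(x,y)=\frac{1}{n+1}\left\{\beta_{n+1,\lambda}^{(c)}(x+1,y)-\beta_{n+1,\lambda}^{(c)}(x,y)\right\}$$ and $$S_{n,\lambda}(x,y)=\frac{1}{n+1}\left\{\beta_{n+1,\lambda}^{(s)}(x+1,y)-\beta_{n+1,\lambda}^{(s)}(x,y)\right\}.$$
   Context: All generating functions are power series in $t$ around $t=0$. For nonzero $\lambda\in\mathbb{R}$ and complex $z$, the degenerate exponential is $e_\lambda^{z}(t)=(1+\lambda t)^{z/\lambda}$, and $e_\lambda(t)=e_\lambda^1(t)$. The degenerate cosine and sine functions are $\cos_\lambda^{(y)}(t)=\frac{e_\lambda^{iy}(t)+e_\lambda^{-iy}(t)}{2}=\cos\left(\frac{y}{\lambda}\log(1+\lambda t)\right)$ and $\sin_\lambda^{(y)}(t)=\frac{e_\lambda^{iy}(t)-e_\lambda^{-iy}(t)}{2i}=\sin\left(\frac{y}{\lambda}\log(1+\lambda t)\right)$, with $i=\sqrt{-1}$. The degenerate cosine-Bernoulli and sine-Bernoulli polynomials are defined by $\frac{t}{e_\lambda(t)-1}e_\lambda^{x}(t)\cos_\lambda^{(y)}(t)=\sum_{n=0}^{\infty}\beta_{n,\lambda}^{(c)}(x,y)\frac{t^n}{n!}$ and $\frac{t}{e_\lambda(t)-1}e_\lambda^{x}(t)\sin_\lambda^{(y)}(t)=\sum_{n=0}^{\infty}\beta_{n,\lambda}^{(s)}(x,y)\frac{t^n}{n!}$.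 The degenerate cosine-polynomials and sine-polynomials are defined by $e_\lambda^{x}(t)\cos_\lambda^{(y)}(t)=\sum_{n=0}^{\infty}C_{n,\lambda}(x,y)\frac{t^n}{n!}$ and $e_\lambda^{x}(t)\sin_\lambda^{(y)}(t)=\sum_{n=0}^{\infty}S_{n,\lambda}(x,y)\frac{t^n}{n!}$. *)

theory Defs
  imports "HOL-Complex_Analysis.Laurent_Convergence"
begin

text \<open>
  All generating functions are formal power series in \<open>t = fps_X\<close> with complex coefficients.
  The power \<open>(1 + \<lambda> t) powr (z / \<lambda>)\<close> is the binomial series with exponent \<open>z / \<lambda>\<close>, taken at
  \<open>\<lambda> t\<close>; \<open>degen_exp_has_fps_expansion\<close> below confirms that it is the expansion at \<open>0\<close> of
  the function.
\<close>

definition degen_exp :: "real \<Rightarrow> complex \<Rightarrow> complex fps" where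
  "degen_exp lam z =
     fps_binomial (z / of_real lam) oo (fps_const (of_real lam) * fps_X)"

definition degen_cos :: "real \<Rightarrow> real \<Rightarrow> complex fps" where
  "degen_cos lam y =
     (degen_exp lam (\<i> * of_real y) + degen_exp lam (- \<i> * of_real y)) / fps_const 2"

definition degen_sin :: "real \<Rightarrow> real \<Rightarrow> complex fps" where
  "degen_sin lam y =
     (degen_exp lam (\<i> * of_real y) - degen_exp lam (- \<i> * of_real y)) / fps_const (2 * \<i>)"

text \<open>
  The quotient below is the division of formal power series: for \<open>\<lambda> \<noteq> 0\<close> the denominator has
  subdegree 1, so that it divides \<open>fps_X\<close> exactly (\<open>degen_bernoulli_gf_mult\<close>).
\<close>

definition degen_bernoulli_gf :: "real \<Rightarrow> complex fps" where
  "degen_bernoulli_gf lam = fps_X / (degen_exp lam 1 - 1)"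

text \<open>The coefficient of \<open>t ^ n / n!\<close> in \<open>F\<close> is \<open>n! * fps_nth F n\<close>.\<close>

definition degen_cos_bernoulli :: "nat \<Rightarrow> real \<Rightarrow> real \<Rightarrow> real \<Rightarrow> complex" where
  "degen_cos_bernoulli n lam x y =
     fact n * fps_nth (degen_bernoulli_gf lam * degen_exp lam (of_real x) * degen_cos lam y) n"

definition degen_sin_bernoulli :: "nat \<Rightarrow> real \<Rightarrow> real \<Rightarrow> real \<Rightarrow> complex" where
  "degen_sin_bernoulli n lam x y =
     fact n * fps_nth (degen_bernoulli_gf lam * degen_exp lam (of_real x) * degen_sin lam y) n"

definition degen_cos_poly :: "nat \<Rightarrow> real \<Rightarrow> real \<Rightarrow> real \<Rightarrow> complex" where
  "degen_cos_poly n lam x y = fact n * fps_nth (degen_exp lam (of_real x) * degen_cos lam y) n"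

definition degen_sin_poly :: "nat \<Rightarrow> real \<Rightarrow> real \<Rightarrow> real \<Rightarrow> complex" where
  "degen_sin_poly n lam x y = fact n * fps_nth (degen_exp lam (of_real x) * degen_sin lam y) n"

lemma degen_exp_nth:
  "fps_nth (degen_exp lam z) n = ((z / of_real lam) gchoose n) * of_real lam ^ n"
  unfolding degen_exp_def fps_nth_compose_linear by simp

lemma degen_exp_has_fps_expansion:
  "(\<lambda>t. (1 + of_real lam * t) powr (z / of_real lam)) has_fps_expansion degen_exp lam z"
proof -
  have "((\<lambda>u. (1 + u) powr (z / of_real lam)) \<circ> (\<lambda>t. of_real lam * t)) has_fps_expansion
          (fps_binomial (z / of_real lam) oo (fps_const (of_real lam) * fps_X))"
    by (rule has_fps_expansion_compose[OF has_fps_expansion_binomial_complex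
          has_fps_expansion_cmult_left[OF has_fps_expansion_fps_X]]) simp
  then show ?thesis by (simp add: degen_exp_def o_def)
qed

lemma eventually_degen_powr:
  assumes "lam \<noteq> 0"
  shows "\<forall>\<^sub>F t in nhds (0::complex). 1 + of_real lam * t \<noteq> 0"
proof -
  have "isCont (\<lambda>t::complex. 1 + of_real lam * t) 0"
    by (intro continuous_intros)
  then have "\<forall>\<^sub>F t in at 0. 1 + of_real lam * t \<noteq> (0::complex)"
    unfolding isCont_def by (rule tendsto_imp_eventually_ne) simp
  then show ?thesis by (simp add: eventually_nhds_conv_at)
qed

lemma degen_cos_has_fps_expansion:
  assumes "lam \<noteq> 0"
  shows "(\<lambda>t. cos (of_real y / of_real lam * Ln (1 + of_real lam * t)))
           has_fps_expansion degen_cos lam y"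
proof -
  define P where "P z t = (1 + of_real lam * t) powr (z / of_real lam)" for z t :: complex
  have "(\<lambda>t. (P (\<i> * of_real y) t + P (- \<i> * of_real y) t) * inverse 2) has_fps_expansion
          (degen_exp lam (\<i> * of_real y) + degen_exp lam (- \<i> * of_real y)) * fps_const (inverse 2)"
    unfolding P_def by (intro has_fps_expansion_cmult_right has_fps_expansion_add degen_exp_has_fps_expansion)
  also have "(degen_exp lam (\<i> * of_real y) + degen_exp lam (- \<i> * of_real y)) * fps_const (inverse 2)
      = degen_cos lam y"
    unfolding degen_cos_def by (subst fps_divide_unit) (simp_all only: fps_const_inverse, simp_all)
  finally have *: "(\<lambda>t. (P (\<i> * of_real y) t + P (- \<i> * of_real y) t) * inverse 2)
      has_fps_expansion degen_cos lam y" .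
  have "\<forall>\<^sub>F t in nhds 0. (P (\<i> * of_real y) t + P (- \<i> * of_real y) t) * inverse 2
      = cos (of_real y / of_real lam * Ln (1 + of_real lam * t))"
    using eventually_degen_powr[OF assms]
  proof eventually_elim
    case (elim t)
    let ?w = "of_real y / of_real lam * Ln (1 + of_real lam * t)"
    have "P (\<i> * of_real y) t = exp (\<i> * ?w)" "P (- \<i> * of_real y) t = exp (- (\<i> * ?w))"
      using elim by (simp_all add: P_def powr_def mult.assoc)
    then show ?case
      by (simp only: cos_exp_eq divide_inverse)
  qed
  from iffD1[OF has_fps_expansion_cong[OF this refl] *] show ?thesis .
qed

lemma degen_sin_has_fps_expansion:
  assumes "lam \<noteq> 0"
  shows "(\<lambda>t. sin (of_real y / of_real lam * Ln (1 + of_real lam * t)))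
           has_fps_expansion degen_sin lam y"
proof -
  define P where "P z t = (1 + of_real lam * t) powr (z / of_real lam)" for z t :: complex
  have "(\<lambda>t. (P (\<i> * of_real y) t - P (- \<i> * of_real y) t) * inverse (2 * \<i>)) has_fps_expansion
          (degen_exp lam (\<i> * of_real y) - degen_exp lam (- \<i> * of_real y)) * fps_const (inverse (2 * \<i>))"
    unfolding P_def by (intro has_fps_expansion_cmult_right has_fps_expansion_diff degen_exp_has_fps_expansion)
  also have "(degen_exp lam (\<i> * of_real y) - degen_exp lam (- \<i> * of_real y)) * fps_const (inverse (2 * \<i>))
      = degen_sin lam y"
    unfolding degen_sin_def by (subst fps_divide_unit) (simp_all only: fps_const_inverse, simp_all)
  finally have *: "(\<lambda>t. (P (\<i> * of_real y) t - P (- \<i> * of_real y) t) * inverse (2 * \<i>))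
      has_fps_expansion degen_sin lam y" .
  have "\<forall>\<^sub>F t in nhds 0. (P (\<i> * of_real y) t - P (- \<i> * of_real y) t) * inverse (2 * \<i>)
      = sin (of_real y / of_real lam * Ln (1 + of_real lam * t))"
    using eventually_degen_powr[OF assms]
  proof eventually_elim
    case (elim t)
    let ?w = "of_real y / of_real lam * Ln (1 + of_real lam * t)"
    have "P (\<i> * of_real y) t = exp (\<i> * ?w)" "P (- \<i> * of_real y) t = exp (- (\<i> * ?w))"
      using elim by (simp_all add: P_def powr_def mult.assoc)
    then show ?case
      by (simp only: sin_exp_eq divide_inverse)
  qed
  from iffD1[OF has_fps_expansion_cong[OF this refl] *] show ?thesis .
qed

lemma degen_bernoulli_gf_mult:
  assumes "lam \<noteq> 0"
  shows "degen_bernoulli_gf lam * (degen_exp lam 1 - 1) = fps_X"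
proof -
  define u where "u = fps_shift 1 (degen_exp lam 1 - 1)"
  have u0: "fps_nth u 0 = 1"
    using assms by (simp add: u_def degen_exp_nth)
  have "degen_exp lam 1 - 1 = fps_X * u"
    unfolding fps_eq_iff by (auto simp: u_def degen_exp_nth)
  moreover have "u * inverse u = 1"
    using u0 by (simp add: inverse_mult_eq_1')
  ultimately have "fps_X = (degen_exp lam 1 - 1) * inverse u"
    by (simp add: mult.assoc)
  then have "degen_exp lam 1 - 1 dvd fps_X" by (rule dvdI)
  then show ?thesis unfolding degen_bernoulli_gf_def by (rule dvd_div_mult_self)
qed

end

theory Submission
  imports Defs
begin

text \<open>Exponents add, so raising x by 1 multiplies the Bernoulli generating function by
  \<open>degen_exp lam 1\<close>. The difference of the two series thus carries the factor
  \<open>degen_exp lam 1 - 1\<close>, which cancels the denominator and leaves t times the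
  generating function of C or S. Coefficients at t^(n+1) are then compared.\<close>

lemma degen_exp_add: "degen_exp lam (z + w) = degen_exp lam z * degen_exp lam w"
  unfolding degen_exp_def add_divide_distrib fps_binomial_add_mult
  by (rule fps_compose_mult_distrib) simp

text \<open>The cancellation never touches the trigonometric factor, so an arbitrary series
  \<open>F\<close> stands for it and serves both cosine and sine.\<close>

lemma bernoulli_gf_difference_nth:
  assumes "lam \<noteq> 0"
  shows "fact n * fps_nth (degen_exp lam (of_real x) * F) n =
           1 / of_nat (n + 1) *
             (fact (n + 1) * fps_nth (degen_bernoulli_gf lam * degen_exp lam (of_real (x + 1)) * F) (n + 1) -
              fact (n + 1) * fps_nth (degen_bernoulli_gf lam * degen_exp lam (of_real x) * F) (n + 1))"
proof -
  let ?B = "degen_bernoulli_gf lam" and ?E = "degen_exp lam (of_real x)"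
  have "?B * degen_exp lam (of_real (x + 1)) * F - ?B * ?E * F
      = ?B * (degen_exp lam 1 - 1) * (?E * F)"
    by (simp add: degen_exp_add algebra_simps)
  also have "\<dots> = fps_X * (?E * F)"
    by (simp only: degen_bernoulli_gf_mult[OF assms])
  \<comment> \<open>The factor \<open>fps_X\<close> shifts the index: coefficient n+1 on the left
    meets coefficient n on the right.\<close>
  finally have "fps_nth (?B * degen_exp lam (of_real (x + 1)) * F) (n + 1) -
      fps_nth (?B * ?E * F) (n + 1) = fps_nth (?E * F) n"
    by (simp flip: fps_sub_nth)
  moreover have "of_nat (n + 1) \<noteq> (0::complex)"
    by (simp only: of_nat_eq_0_iff)
  \<comment> \<open>Since (n+1)! = (n+1) n!, the prefactor 1/(n+1) turns the weight (n+1)! into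
    n!.\<close>
  ultimately show ?thesis
    by (simp add: fact_Suc field_simps del: of_nat_Suc flip: right_diff_distrib)
qed

theorem theorem3p3:
  fixes lam x y :: real and n :: nat
  assumes "lam \<noteq> 0"
  shows "degen_cos_poly n lam x y =
           1 / of_nat (n + 1) *
             (degen_cos_bernoulli (n + 1) lam (x + 1) y - degen_cos_bernoulli (n + 1) lam x y)
       \<and> degen_sin_poly n lam x y =
           1 / of_nat (n + 1) *
             (degen_sin_bernoulli (n + 1) lam (x + 1) y - degen_sin_bernoulli (n + 1) lam x y)"
  unfolding degen_cos_poly_def degen_sin_poly_def degen_cos_bernoulli_def degen_sin_bernoulli_def
  by (intro conjI bernoulli_gf_difference_nth assms)

end
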